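(* In the semi-synchronous Eventual Transport (ET) model with chirality, two agents can perform an unconscious exploration of the 1-interval connected ring; that is, there is an algorithm such that in every execution every node is, within finite time, visited by at least one agent.
   Context: Ring: the nodes $v_0,\dots,v_{n-1}$ (indices modulo $n$) form a cycle; $v_i$ is linked to $v_{i-1}$ and $v_{i+1}$ via distinctly labelled ports $q_{i-}$ and $q_{i+}$ (labels need not be globally consistent). Time proceeds in rounds; in each round at most one edge, chosen by an adversary, is missing (1-interval connected ring). Nodes are anonymous (no distinguishable identifiers), and the agents have no information on $n$. Agents: each has memory and computational power; they are anonymous (no identifiers) and all execute the same deterministic protocol. They start at arbitrary, not necessarily distinct, nodes, cannot communicate explicitly and cannot mark nodes. Each agent $a_j$ has a consistent private orientation, i.e. a function $\lambda_j$ designating each port left or right with $\lambda_j(q_{i-})=\lambda_j(q_{k-})$ for all $i,k$. Chirality: all agents have the same orientation and are aware of it. Round: each active agent performs Look (it sees its own position within its node, i.e. whether it is on a port and which one, and the positions of the other agents at that node), Compute (from this snapshot and its memory it determines a direction in $\{left,right,nil\}$; if $nil$ it becomes inactive; otherwise it tries to access the corresponding port if not already there), and Move. Ports are accessed in mutual exclusion: an occupied port cannot be gained, and if several agents try the same port exactly one succeeds; an agent that fails sets $moved=false$ and becomes inactive. An agent on a port after computing moves to the other endpoint if the edge is present in this round (setting $moved=true$), and otherwise stays on the port (setting $moved=false$); in either case the port is denied to other agents in that round. Two agents crossing the same edge in opposite directions in the same round might not detect each other. Semi-synchronous ($\mathcal{SSYNC}$): in each round an adversary activates a non-empty subset of the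 agents, the others being asleep (passive); every agent is activated infinitely often; an activated agent does not know whether it was active in the previous round. An agent may be asleep on a port. ET model: a sleeping agent cannot move; if an agent is sleeping on a port at round $t$ and the corresponding edge is present infinitely many times, then the agent will eventually become active at a round $t'>t$ when the corresponding edge is present. Unconscious exploration: within finite time every node is visited by at least one agent, in every execution (all initial positions and all adversary choices); the agents are not required to stop nor to be aware that the ring has been visited. *)

theory Defs
  imports Main
begin

text \<open>
  Nodes of the ring are the numbers \<open>i < n\<close>; \<open>Minus\<close> and \<open>Plus\<close> name the ports \<open>q\<^sub>i\<^sub>-\<close> and \<open>q\<^sub>i\<^sub>+\<close>
  of a node. Edge \<open>i < n\<close> joins the \<open>Plus\<close> port of node \<open>i\<close> to the \<open>Minus\<close> port of node
  \<open>(i + 1) mod n\<close>. Agents are the numbers \<open>a < k\<close>; these indices and the node numbers occur only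
  in the description of the system and are never visible to the protocol.
\<close>

datatype side = Minus | Plus

datatype dir = Left | Right

fun neighbour :: "nat \<Rightarrow> nat \<Rightarrow> side \<Rightarrow> nat" where
  "neighbour n i Plus = (i + 1) mod n"
| "neighbour n i Minus = (i + n - 1) mod n"

fun edge_at :: "nat \<Rightarrow> nat \<Rightarrow> side \<Rightarrow> nat" where
  "edge_at n i Plus = i"
| "edge_at n i Minus = (i + n - 1) mod n"

text \<open>
  \<open>lam a i p\<close> is the direction that agent \<open>a\<close> assigns to port \<open>p\<close> of node \<open>i\<close>.
\<close>

type_synonym orientation = "nat \<Rightarrow> nat \<Rightarrow> side \<Rightarrow> dir"

definition consistent_orientation :: "nat \<Rightarrow> nat \<Rightarrow> orientation \<Rightarrow> bool" where
  "consistent_orientation n k lam \<longleftrightarrow>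
     (\<forall>a<k. (\<forall>i<n. lam a i Minus \<noteq> lam a i Plus) \<and>
            (\<forall>i<n. \<forall>j<n. \<forall>p. lam a i p = lam a j p))"

definition chirality :: "nat \<Rightarrow> nat \<Rightarrow> orientation \<Rightarrow> bool" where
  "chirality n k lam \<longleftrightarrow> (\<forall>a<k. \<forall>b<k. \<forall>i<n. \<forall>p. lam a i p = lam b i p)"

text \<open>
  Positions within a node are options: \<open>None\<close> is the node itself, off the ports. A snapshot is
  expressed in the private orientation of the observer; agents being anonymous, it only counts the
  other agents at each position of the node. In a decision, \<open>None\<close> stands for \<open>nil\<close>.
\<close>

record snapshot =
  own :: "dir option"
  others :: "dir option \<Rightarrow> nat"

record 'm protocol =
  init_mem :: 'm
  compute :: "'m \<Rightarrow> bool \<Rightarrow> snapshot \<Rightarrow> 'm \<times> dir option" \<comment> \<open>the \<open>bool\<close> is the flag \<open>moved\<close>\<close>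

record 'm agent_state =
  node :: nat
  port :: "side option"
  mem :: 'm
  moved :: bool

type_synonym 'm config = "nat \<Rightarrow> 'm agent_state"

definition look :: "nat \<Rightarrow> orientation \<Rightarrow> 'm config \<Rightarrow> nat \<Rightarrow> snapshot" where
  "look k lam C a =
     (let view = (\<lambda>b. map_option (lam a (node (C a))) (port (C b)))
      in \<lparr>own = view a,
          others = (\<lambda>q. card {b. b < k \<and> b \<noteq> a \<and> node (C b) = node (C a) \<and> view b = q})\<rparr>)"

definition computed :: "nat \<Rightarrow> 'm protocol \<Rightarrow> orientation \<Rightarrow> 'm config \<Rightarrow> nat \<Rightarrow> 'm \<times> dir option" where
  "computed k P lam C a = compute P (mem (C a)) (moved (C a)) (look k lam C a)"

text \<open>The port, if any, of its current node that the agent has decided to leave through.\<close>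

definition chosen_port :: "nat \<Rightarrow> 'm protocol \<Rightarrow> orientation \<Rightarrow> 'm config \<Rightarrow> nat \<Rightarrow> side option" where
  "chosen_port k P lam C a =
     map_option (\<lambda>d. THE p. lam a (node (C a)) p = d) (snd (computed k P lam C a))"

definition occupied :: "nat \<Rightarrow> 'm config \<Rightarrow> nat \<Rightarrow> side \<Rightarrow> bool" where
  "occupied k C i p \<longleftrightarrow> (\<exists>b<k. node (C b) = i \<and> port (C b) = Some p)"

text \<open>The active agents, given by \<open>S\<close>, that compete for port \<open>p\<close> of node \<open>i\<close>.\<close>

definition contenders ::
  "nat \<Rightarrow> 'm protocol \<Rightarrow> orientation \<Rightarrow> nat set \<Rightarrow> 'm config \<Rightarrow> nat \<Rightarrow> side \<Rightarrow> nat set" where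
  "contenders k P lam S C i p =
     {a \<in> S. node (C a) = i \<and> chosen_port k P lam C a = Some p \<and> port (C a) \<noteq> Some p}"

text \<open>
  \<open>G\<close> is a possible set of agents that gain access to a port in this round. A port occupied at
  the beginning of the round cannot be gained in it, not even if its occupant leaves it.
\<close>

definition admissible_access ::
  "nat \<Rightarrow> nat \<Rightarrow> 'm protocol \<Rightarrow> orientation \<Rightarrow> nat set \<Rightarrow> 'm config \<Rightarrow> nat set \<Rightarrow> bool" where
  "admissible_access n k P lam S C G \<longleftrightarrow>
     (\<forall>i<n. \<forall>p. let T = contenders k P lam S C i p in
        (if occupied k C i p \<or> T = {} then G \<inter> T = {} else card (G \<inter> T) = 1))"

text \<open>
  The effect of a round on an active agent. \<open>access\<close> tells whether it has gained a port, and
  \<open>miss\<close> is the missing edge, if any. An agent that decides \<open>nil\<close> or fails to gain a port keeps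
  its position.
\<close>

definition act ::
  "nat \<Rightarrow> nat \<Rightarrow> 'm protocol \<Rightarrow> orientation \<Rightarrow> nat option \<Rightarrow> bool \<Rightarrow> 'm config \<Rightarrow> nat \<Rightarrow> 'm agent_state" where
  "act n k P lam miss access C a =
     (let s = (C a)\<lparr>mem := fst (computed k P lam C a)\<rparr>
      in case chosen_port k P lam C a of
           None \<Rightarrow> s
         | Some p \<Rightarrow>
             if port s = Some p \<or> access then
               if miss \<noteq> Some (edge_at n (node s) p)
               then s\<lparr>node := neighbour n (node s) p, port := None, moved := True\<rparr>
               else s\<lparr>port := Some p, moved := False\<rparr>
             else s\<lparr>moved := False\<rparr>)"

definition round_step ::
  "nat \<Rightarrow> nat \<Rightarrow> 'm protocol \<Rightarrow> orientation \<Rightarrow> nat set \<Rightarrow> nat option \<Rightarrow> 'm config \<Rightarrow> 'm config \<Rightarrow> bool" where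
  "round_step n k P lam S miss C C' \<longleftrightarrow>
     (\<exists>G. admissible_access n k P lam S C G \<and>
          (\<forall>a<k. C' a = (if a \<in> S then act n k P lam miss (a \<in> G) C a else C a)))"

definition initial :: "nat \<Rightarrow> nat \<Rightarrow> 'm protocol \<Rightarrow> 'm config \<Rightarrow> bool" where
  "initial n k P C \<longleftrightarrow>
     (\<forall>a<k. node (C a) < n \<and> port (C a) = None \<and> mem (C a) = init_mem P \<and> \<not> moved (C a))"

text \<open>
  In round \<open>t\<close> the agents in \<open>S t\<close> are active, \<open>E t\<close> is the missing edge (\<open>None\<close> if all edges are
  present), and the configuration changes from \<open>C t\<close> to \<open>C (Suc t)\<close>.
\<close>

definition ssync_execution ::
  "nat \<Rightarrow> nat \<Rightarrow> 'm protocol \<Rightarrow> orientation \<Rightarrow> (nat \<Rightarrow> nat set) \<Rightarrow> (nat \<Rightarrow> nat option) \<Rightarrow>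
   (nat \<Rightarrow> 'm config) \<Rightarrow> bool" where
  "ssync_execution n k P lam S E C \<longleftrightarrow>
     initial n k P (C 0) \<and>
     (\<forall>t. S t \<noteq> {} \<and> S t \<subseteq> {..<k}) \<and>
     (\<forall>a<k. infinite {t. a \<in> S t}) \<and>
     (\<forall>t e. E t = Some e \<longrightarrow> e < n) \<and>
     (\<forall>t. round_step n k P lam (S t) (E t) (C t) (C (Suc t)))"

definition eventual_transport ::
  "nat \<Rightarrow> nat \<Rightarrow> (nat \<Rightarrow> nat set) \<Rightarrow> (nat \<Rightarrow> nat option) \<Rightarrow> (nat \<Rightarrow> 'm config) \<Rightarrow> bool" where
  "eventual_transport n k S E C \<longleftrightarrow>
     (\<forall>a<k. \<forall>t p. a \<notin> S t \<and> port (C t a) = Some p \<longrightarrow>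
        (let e = edge_at n (node (C t a)) p in
           infinite {u. E u \<noteq> Some e} \<longrightarrow> (\<exists>u>t. a \<in> S u \<and> E u \<noteq> Some e)))"

definition explored :: "nat \<Rightarrow> nat \<Rightarrow> (nat \<Rightarrow> 'm config) \<Rightarrow> bool" where
  "explored n k C \<longleftrightarrow> (\<exists>T. \<forall>i<n. \<exists>t\<le>T. \<exists>a<k. node (C t a) = i)"

text \<open>
  \<open>k\<close> agents running \<open>P\<close> explore the ring of size \<open>n\<close> in every execution of the semi-synchronous
  eventual transport model with chirality.
\<close>

definition unconscious_exploration_ET_chirality :: "nat \<Rightarrow> nat \<Rightarrow> 'm protocol \<Rightarrow> bool" where
  "unconscious_exploration_ET_chirality n k P \<longleftrightarrow>
     (\<forall>lam S E C.
        consistent_orientation n k lam \<longrightarrow> chirality n k lam \<longrightarrow>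
        ssync_execution n k P lam S E C \<longrightarrow> eventual_transport n k S E C \<longrightarrow>
        explored n k C)"

end

theory Submission imports Defs begin

text \<open>
  Every agent walks left; an agent that stands off the ports and sees the other one on the left
  port of its node turns around and walks right for ever. An agent on a right port never makes the
  other one turn, so at most one agent turns, and an agent that moves infinitely often explores
  the ring. Suppose that both agents stop. Each of them then ends up on the port it wants, so
  that by eventual transport its edge is missing from some round on; as one edge is missing at a
  time, both are blocked at the same edge. By mutual exclusion they stand at its two ends, so one
  of them has turned. They parted from a common node in opposite directions, hence the nodes they
  have visited since then are closed under going left, across the blocked edge as well.
\<close>

section \<open>Neighbours and edges of the ring\<close>

fun opposite :: "side \<Rightarrow> side" where
  "opposite Minus = Plus"
| "opposite Plus = Minus"

lemma opposite_neq [simp]: "opposite p \<noteq> p" "p \<noteq> opposite p"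
  by (cases p; simp)+

lemma neighbour_less: "0 < n \<Longrightarrow> neighbour n i p < n"
  by (cases p) auto

lemma neighbour_neq:
  assumes "1 < n" "i < n"
  shows "neighbour n i p \<noteq> i"
proof (cases p)
  case Plus
  then show ?thesis using assms by (cases "i + 1 = n") auto
next
  case Minus
  show ?thesis
  proof (cases i)
    case (Suc j)
    then have "i + n - 1 = j + n" by simp
    then show ?thesis using Minus assms Suc by simp
  qed (use Minus assms in simp)
qed

text \<open>Case distinctions replace the modulus here and in \<open>neighbour_Plus\<close>, which
  reduces the incidence facts below to linear arithmetic.\<close>

lemma neighbour_Minus: "i < n \<Longrightarrow> neighbour n i Minus = (if i = 0 then n - 1 else i - 1)"
proof (cases i)
  case (Suc j)
  assume "i < n"
  then have "i + n - 1 = j + n" using Suc by simp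
  then show ?thesis using \<open>i < n\<close> Suc by simp
qed simp

lemma neighbour_Plus: "i < n \<Longrightarrow> neighbour n i Plus = (if i = n - 1 then 0 else i + 1)"
  by auto

lemma edge_at_Minus: "edge_at n i Minus = neighbour n i Minus"
  by simp

lemmas ring_cases = neighbour_Minus neighbour_Plus edge_at_Minus

lemma neighbour_opposite: "i < n \<Longrightarrow> neighbour n (neighbour n i (opposite p)) p = i"
  by (cases p) (auto simp: ring_cases simp del: neighbour.simps edge_at.simps(2))

lemma edge_at_inj: "i < n \<Longrightarrow> j < n \<Longrightarrow> edge_at n i p = edge_at n j p \<Longrightarrow> i = j"
  by (cases p) (auto simp: ring_cases simp del: neighbour.simps edge_at.simps(2) split: if_splits)

lemma edge_at_opposite:
  "i < n \<Longrightarrow> j < n \<Longrightarrow> edge_at n i p = edge_at n j (opposite p) \<Longrightarrow> neighbour n i p = j"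
  by (cases p) (auto simp: ring_cases simp del: neighbour.simps edge_at.simps(2) split: if_splits)

text \<open>Following \<open>p\<close> from \<open>w\<close> leads to the end of the range of node
  numbers, wraps around once, and then runs through all of it.\<close>

lemma neighbour_closed_all:
  assumes W: "W \<subseteq> {..<n}" "w \<in> W"
    and closed: "\<And>i. i \<in> W \<Longrightarrow> neighbour n i p \<in> W"
  shows "{..<n} \<subseteq> W"
proof -
  have "w < n" using W by auto
  show ?thesis
  proof (cases p)
    case Plus
    have up: "v + j \<in> W" if "v \<in> W" "v + j < n" for v j
      using that(2)
    proof (induction j)
      case (Suc j)
      then have "v + j \<noteq> n - 1" by linarith
      then show ?case using Suc closed[of "v + j"] Plus by (simp add: neighbour_Plus del: neighbour.simps)
    qed (use that in simp)
    have "n - 1 \<in> W" using up[of w "n - 1 - w"] \<open>w < n\<close> W by simp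
    then have "0 \<in> W" using closed[of "n - 1"] Plus \<open>w < n\<close>
      by (simp add: neighbour_Plus del: neighbour.simps)
    then show ?thesis using up[of 0] by auto
  next
    case Minus
    \<comment> \<open>Subtraction is truncated: once \<open>j\<close> reaches \<open>v\<close>, the
      claim only repeats that node 0 is in \<open>W\<close>.\<close>
    have down: "v - j \<in> W" if "v \<in> W" for v j
    proof (induction j)
      case (Suc j)
      then show ?case using closed[of "v - j"] Minus W
        by (cases "v \<le> j") (auto simp: neighbour_Minus simp del: neighbour.simps)
    qed (use that in simp)
    have "0 \<in> W" using down[of w w] W by simp
    then have "n - 1 \<in> W" using closed[of 0] Minus \<open>w < n\<close>
      by (simp add: neighbour_Minus del: neighbour.simps)
    show ?thesis
    proof
      fix i assume "i \<in> {..<n}"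
      then show "i \<in> W" using down[OF \<open>n - 1 \<in> W\<close>, of "n - 1 - i"] by simp
    qed
  qed
qed

text \<open>One time bound has to serve all nodes; as they are finitely many, the maximum of
  individual visiting times will do.\<close>

lemma exploredI:
  assumes "\<And>i. i < n \<Longrightarrow> \<exists>t. \<exists>a<k. node (C t a) = i"
  shows "explored n k C"
proof -
  obtain f where f: "\<And>i. i < n \<Longrightarrow> \<exists>a<k. node (C (f i) a) = i"
    using assms by metis
  have "f i \<le> Max (f ` {..<n})" if "i < n" for i using that by simp
  then show ?thesis unfolding explored_def using f by blast
qed

section \<open>Mutual exclusion on ports\<close>

definition ports_exclusive :: "nat \<Rightarrow> 'm config \<Rightarrow> bool" where
  "ports_exclusive k C \<longleftrightarrow>
     (\<forall>a<k. \<forall>b<k. a \<noteq> b \<longrightarrow> port (C a) \<noteq> None \<longrightarrow> node (C a) = node (C b) \<longrightarrow>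
        port (C a) \<noteq> port (C b))"

text \<open>Crossing an edge leaves an agent off the ports, so one that ends its action on a port
  has not moved: it held the port already or has just gained it.\<close>

lemma act_on_port:
  assumes "port (act n k P lam miss access C a) = Some p"
  shows "node (act n k P lam miss access C a) = node (C a)"
    and "port (C a) = Some p \<or> access \<and> chosen_port k P lam C a = Some p \<and> port (C a) \<noteq> Some p"
  using assms by (auto simp: act_def Let_def split: option.splits if_splits)

text \<open>Of two agents sharing a port after the round, each held it before or has just won it.
  Two holders contradict the invariant, a holder and a winner contradict that an occupied port
  cannot be gained, and two winners contradict \<open>card (G \<inter> T) = 1\<close>.\<close>

lemma ports_exclusive_step:
  assumes "round_step n k P lam S miss C C'" "ports_exclusive k C" "\<And>a. a < k \<Longrightarrow> node (C a) < n"
    and "S \<subseteq> {..<k}"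
  shows "ports_exclusive k C'"
proof (rule ccontr)
  assume "\<not> ports_exclusive k C'"
  then obtain a b p where ab: "a < k" "b < k" "a \<noteq> b" "node (C' a) = node (C' b)"
    and p: "port (C' a) = Some p" "port (C' b) = Some p"
    unfolding ports_exclusive_def by (metis not_None_eq)
  obtain G where adm: "admissible_access n k P lam S C G"
    and C': "\<And>c. c < k \<Longrightarrow> C' c = (if c \<in> S then act n k P lam miss (c \<in> G) C c else C c)"
    using assms(1) unfolding round_step_def by blast
  define T where "T = contenders k P lam S C (node (C a)) p"
  have src: "node (C' c) = node (C c) \<and>
      (port (C c) = Some p \<or> c \<in> G \<inter> contenders k P lam S C (node (C c)) p)"
    if "c < k" "port (C' c) = Some p" for c
    using that C'[of c] act_on_port[of n k P lam miss "c \<in> G" C c p]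
    by (auto simp: contenders_def split: if_splits)
  have eq: "node (C a) = node (C b)" using src ab p by metis
  have *: "if occupied k C (node (C a)) p \<or> T = {} then G \<inter> T = {} else card (G \<inter> T) = 1"
    using adm assms(3)[OF ab(1)] unfolding admissible_access_def T_def by (auto simp: Let_def)
  have a: "port (C a) = Some p \<or> a \<in> G \<inter> T" and b: "port (C b) = Some p \<or> b \<in> G \<inter> T"
    using src[OF ab(1) p(1)] src[OF ab(2) p(2)] eq by (auto simp: T_def)
  have "\<not> (port (C a) = Some p \<and> port (C b) = Some p)"
    using assms(2) ab eq unfolding ports_exclusive_def by (metis option.distinct(1))
  moreover have "\<not> occupied k C (node (C a)) p \<or> G \<inter> T = {}" using * by (auto split: if_splits)
  ultimately have "a \<in> G \<inter> T" "b \<in> G \<inter> T" "card (G \<inter> T) = 1"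
    using a b ab eq * unfolding occupied_def by (auto split: if_splits)
  then show False using ab by (metis card_1_singletonE singletonD)
qed

section \<open>The protocol and one round of it\<close>

text \<open>Memory 0 stands for walking left and 1 for having turned. The direction is computed from
  the updated memory, so a turn takes effect in the same round.\<close>

definition bounce :: "nat protocol" where
  "bounce = \<lparr>init_mem = 0, compute = (\<lambda>m _ s.
     let m' = (if m = 0 \<and> own s = None \<and> others s (Some Left) > 0 then 1 else m)
     in (m', Some (if m' = 0 then Left else Right)))\<rparr>"

text \<open>The side \<open>l\<close> is the one that both agents call left. With at least two
  nodes, crossing an edge always changes the node; the ring with one node is treated
  separately.\<close>

locale bounce_execution =
  fixes n :: nat and lam :: orientation and S :: "nat \<Rightarrow> nat set"
    and E :: "nat \<Rightarrow> nat option" and C :: "nat \<Rightarrow> nat config" and l :: side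
  assumes n: "1 < n"
    and lam: "\<And>a i p. a < 2 \<Longrightarrow> i < n \<Longrightarrow> lam a i p = (if p = l then Left else Right)"
    and exec: "ssync_execution n 2 bounce lam S E C"
    and et: "eventual_transport n 2 S E C"
begin

text \<open>Memory is updated before the direction is chosen, so an agent active in round
  \<open>t\<close> tries the port \<open>heading (Suc t) a\<close>.\<close>

definition heading :: "nat \<Rightarrow> nat \<Rightarrow> side" where
  "heading t a = (if mem (C t a) = 0 then l else opposite l)"

text \<open>\<open>bounces\<close> may hold of a sleeping agent, which then need not turn.\<close>

definition bounces :: "nat \<Rightarrow> nat \<Rightarrow> bool" where
  "bounces t a \<longleftrightarrow> mem (C t a) = 0 \<and> port (C t a) = None \<and>
     (\<exists>b<2. b \<noteq> a \<and> node (C t b) = node (C t a) \<and> port (C t b) = Some l)"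

lemma round: "round_step n 2 bounce lam (S t) (E t) (C t) (C (Suc t))"
  using exec unfolding ssync_execution_def by blast

lemma S_sub: "S t \<subseteq> {..<2}"
  using exec unfolding ssync_execution_def by blast

lemma S_inf: "a < 2 \<Longrightarrow> infinite {t. a \<in> S t}"
  using exec unfolding ssync_execution_def by blast

lemma asleep: "a < 2 \<Longrightarrow> a \<notin> S t \<Longrightarrow> C (Suc t) a = C t a"
  using round[of t] unfolding round_step_def by metis

lemma the_port:
  assumes "a < 2" "i < n"
  shows "(THE p. lam a i p = (if m = 0 then Left else Right)) = (if m = (0::nat) then l else opposite l)"
proof -
  have "lam a i p = Left \<longleftrightarrow> p = l" "lam a i p = Right \<longleftrightarrow> p = opposite l" for p
    using lam[OF assms, of p] by (cases p; cases l; simp)+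
  then show ?thesis by simp
qed

lemma computed_eq:
  assumes "a < 2" "node (C t a) < n"
  shows "computed 2 bounce lam (C t) a =
     (let m' = if bounces t a then 1 else mem (C t a) in (m', Some (if m' = 0 then Left else Right)))"
proof -
  let ?B = "{b. b < 2 \<and> b \<noteq> a \<and> node (C t b) = node (C t a) \<and>
     map_option (lam a (node (C t a))) (port (C t b)) = Some Left}"
  have "finite ?B" by (rule finite_subset[of _ "{..<2}"]) auto
  then have "card ?B > 0 \<longleftrightarrow> (\<exists>b<2. b \<noteq> a \<and> node (C t b) = node (C t a) \<and> port (C t b) = Some l)"
    using assms by (auto simp: card_gt_0_iff lam split: if_splits)
  then show ?thesis
    by (auto simp: computed_def bounce_def look_def Let_def bounces_def)
qed

lemma chosen_eq:
  assumes "a < 2" "node (C t a) < n"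
  shows "chosen_port 2 bounce lam (C t) a =
     Some (if (if bounces t a then 1 else mem (C t a)) = 0 then l else opposite l)"
  unfolding chosen_port_def computed_eq[OF assms] Let_def
  using the_port[OF assms] by (simp split: if_splits)

text \<open>The outcome of a round for an agent that holds or gains the port it wants. Being blocked
  on that port by the missing edge counts as advancing.\<close>

definition advances :: "nat \<Rightarrow> nat \<Rightarrow> bool" where
  "advances t a \<longleftrightarrow>
     (let p = heading (Suc t) a; e = edge_at n (node (C t a)) p in
       if E t = Some e then node (C (Suc t) a) = node (C t a) \<and> port (C (Suc t) a) = Some p
       else node (C (Suc t) a) = neighbour n (node (C t a)) p \<and> port (C (Suc t) a) = None)"

text \<open>An active agent fails to advance only if the other one occupied the wanted port or won
  it in this round, and a winner itself advances. The bound on the nodes is a premise because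
  \<open>node_less\<close> is derived from this lemma by induction.\<close>

lemma active:
  assumes a: "a \<in> S t" and nodes: "\<And>b. b < 2 \<Longrightarrow> node (C t b) < n"
  shows "mem (C (Suc t) a) = (if bounces t a then 1 else mem (C t a))"
    and "advances t a \<or>
      port (C t a) \<noteq> Some (heading (Suc t) a) \<and>
      node (C (Suc t) a) = node (C t a) \<and> port (C (Suc t) a) = port (C t a) \<and>
      (\<exists>b<2. b \<noteq> a \<and> node (C t b) = node (C t a) \<and>
         (port (C t b) = Some (heading (Suc t) a) \<or>
          b \<in> S t \<and> heading (Suc t) b = heading (Suc t) a \<and> advances t b))"
proof -
  obtain G where adm: "admissible_access n 2 bounce lam (S t) (C t) G"
    and C': "\<And>c. c < 2 \<Longrightarrow> C (Suc t) c =
      (if c \<in> S t then act n 2 bounce lam (E t) (c \<in> G) (C t) c else C t c)"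
    using round unfolding round_step_def by blast
  have S2: "c < 2" if "c \<in> S t" for c using that S_sub by auto
  have mem': "mem (C (Suc t) c) = (if bounces t c then 1 else mem (C t c))" if "c \<in> S t" for c
    using that C'[OF S2[OF that]] computed_eq[OF S2[OF that] nodes[OF S2[OF that]]]
    by (auto simp: act_def Let_def split: option.splits)
  have chosen: "chosen_port 2 bounce lam (C t) c = Some (heading (Suc t) c)" if "c \<in> S t" for c
    unfolding chosen_eq[OF S2[OF that] nodes[OF S2[OF that]]] heading_def mem'[OF that] by simp
  have act: "if port (C t c) = Some (heading (Suc t) c) \<or> c \<in> G then advances t c
     else node (C (Suc t) c) = node (C t c) \<and> port (C (Suc t) c) = port (C t c)" if "c \<in> S t" for c
    using that C'[OF S2[OF that]] chosen[OF that] unfolding advances_def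
    by (auto simp: act_def Let_def)
  show "mem (C (Suc t) a) = (if bounces t a then 1 else mem (C t a))" by (rule mem'[OF a])
  have a2: "a < 2" using a S_sub by auto
  let ?p = "heading (Suc t) a" and ?i = "node (C t a)"
  let ?T = "contenders 2 bounce lam (S t) (C t) ?i ?p"
  have "\<exists>b<2. b \<noteq> a \<and> node (C t b) = node (C t a) \<and>
         (port (C t b) = Some (heading (Suc t) a) \<or>
          b \<in> S t \<and> heading (Suc t) b = heading (Suc t) a \<and> advances t b)"
    if fail: "port (C t a) \<noteq> Some ?p" "a \<notin> G"
  proof (cases "occupied 2 (C t) ?i ?p")
    case True
    then show ?thesis using fail unfolding occupied_def by metis
  next
    case False
    \<comment> \<open>A free port with a contender has exactly one winner; it is not
      \<open>a\<close>, which has no access.\<close>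
    have "a \<in> ?T" using a fail chosen unfolding contenders_def by auto
    then have "card (G \<inter> ?T) = 1"
      using adm nodes[OF a2] False unfolding admissible_access_def Let_def by (metis empty_iff)
    then obtain b where b: "b \<in> G" "b \<in> ?T" by (metis IntE card_1_singletonE insertI1)
    then have "b \<in> S t" "node (C t b) = ?i" "heading (Suc t) b = ?p"
      using chosen unfolding contenders_def by auto
    then show ?thesis using act[of b] b fail S_sub by (metis lessThan_iff subsetD)
  qed
  then show "advances t a \<or>
      port (C t a) \<noteq> Some (heading (Suc t) a) \<and>
      node (C (Suc t) a) = node (C t a) \<and> port (C (Suc t) a) = port (C t a) \<and>
      (\<exists>b<2. b \<noteq> a \<and> node (C t b) = node (C t a) \<and>
         (port (C t b) = Some (heading (Suc t) a) \<or>
          b \<in> S t \<and> heading (Suc t) b = heading (Suc t) a \<and> advances t b))"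
    using act[OF a] by (auto split: if_splits)
qed

section \<open>Invariants of an execution\<close>

lemma node_less: "a < 2 \<Longrightarrow> node (C t a) < n"
proof (induction t arbitrary: a)
  case 0
  then show ?case using exec unfolding ssync_execution_def initial_def by blast
next
  case (Suc t)
  show ?case
  proof (cases "a \<in> S t")
    case True
    from active(2)[OF True Suc.IH] show ?thesis
      using Suc neighbour_less[of n] n unfolding advances_def by (auto simp: Let_def split: if_splits)
  qed (use Suc asleep in simp)
qed

lemmas mem_Suc = active(1)[OF _ node_less]
lemmas active_cases = active(2)[OF _ node_less]

lemma mem_mono:
  "a < 2 \<Longrightarrow> mem (C (Suc t) a) = mem (C t a) \<or>
     mem (C t a) = 0 \<and> mem (C (Suc t) a) = 1 \<and> bounces t a \<and> a \<in> S t"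
proof (cases "a \<in> S t")
  case True
  have "bounces t a \<Longrightarrow> mem (C t a) = 0" unfolding bounces_def by blast
  then show ?thesis using True mem_Suc[OF True] by simp
qed (use asleep[of a t] in simp)

text \<open>Turning happens only off the ports, so the memory of an agent on a port never comes to
  disagree with that port.\<close>

lemma port_heading: "a < 2 \<Longrightarrow> port (C t a) = None \<or> port (C t a) = Some (heading t a)"
proof (induction t)
  case 0
  then show ?case using exec unfolding ssync_execution_def initial_def by blast
next
  case (Suc t)
  show ?case
  proof (cases "a \<in> S t")
    case True
    have "bounces t a \<Longrightarrow> port (C t a) = None" unfolding bounces_def by simp
    then have "port (C t a) = None \<or> port (C t a) = Some (heading (Suc t) a)"
      using Suc mem_Suc[OF True] unfolding heading_def by (auto split: if_splits)
    then show ?thesis using active_cases[OF True] unfolding advances_def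
      by (auto simp: Let_def split: if_splits)
  next
    case False
    then show ?thesis using Suc asleep[of a t] by (simp add: heading_def)
  qed
qed

lemma exclusive: "ports_exclusive 2 (C t)"
proof (induction t)
  case 0
  then show ?case using exec unfolding ssync_execution_def initial_def ports_exclusive_def by auto
next
  case (Suc t)
  then show ?case using ports_exclusive_step[OF round] node_less S_sub by blast
qed

text \<open>By \<open>port_heading\<close>, an agent that has turned never stands on port
  \<open>l\<close>, so it cannot make the other one turn. Both cannot turn in the same round, since
  each would have to be off the ports and seen on one.\<close>

lemma one_bouncer:
  assumes "a < 2" "b < 2" "a \<noteq> b"
  shows "mem (C t a) = 0 \<or> mem (C t b) = 0"
proof (induction t)
  case 0
  then show ?case using exec assms unfolding ssync_execution_def initial_def bounce_def by auto
next
  case (Suc t)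
  have no: "\<not> bounces t c" if "c < 2" "d < 2" "c \<noteq> d" "mem (C t d) \<noteq> 0" for c d
  proof
    assume "bounces t c"
    then obtain e where "e < 2" "e \<noteq> c" "port (C t e) = Some l" unfolding bounces_def by blast
    moreover have "e = d" using that calculation by arith
    ultimately show False using port_heading[of d t] that unfolding heading_def by auto
  qed
  have "\<not> (bounces t a \<and> bounces t b)"
    using assms unfolding bounces_def by (metis less_2_cases option.distinct(1))
  then show ?case using Suc mem_mono[of a t] mem_mono[of b t] no[of a b] no[of b a] assms by force
qed

lemma node_Suc:
  "a < 2 \<Longrightarrow> node (C (Suc t) a) = node (C t a) \<or>
     node (C (Suc t) a) = neighbour n (node (C t a)) (heading (Suc t) a)"
  using active_cases[of a t] asleep[of a t] unfolding advances_def
  by (cases "a \<in> S t") (auto simp: Let_def split: if_splits)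


section \<open>Agents that move for ever and agents that stop\<close>

lemma moves_on:
  assumes a: "a < 2" and "t \<le> u" "node (C u a) \<noteq> node (C t a)"
    and p: "\<And>v. t < v \<Longrightarrow> heading v a = p"
  shows "\<exists>v>t. node (C v a) = neighbour n (node (C t a)) p"
proof -
  have "\<exists>v\<ge>t. node (C v a) = node (C t a) \<and> node (C (Suc v) a) \<noteq> node (C t a)"
  proof (rule ccontr)
    assume "\<not> ?thesis"
    then have "node (C (t + d) a) = node (C t a)" for d by (induction d) auto
    from this[of "u - t"] show False using assms by simp
  qed
  then obtain v where "v \<ge> t" "node (C v a) = node (C t a)" "node (C (Suc v) a) \<noteq> node (C t a)"
    by blast
  then show ?thesis using node_Suc[OF a, of v] p[of "Suc v"] by (metis le_imp_less_Suc)
qed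

text \<open>If the agent never stops, the nodes it visits from \<open>T0\<close> on are closed under
  going to side \<open>p\<close>, hence are all nodes.\<close>

lemma explored_or_stops:
  assumes a: "a < 2" and p: "\<And>t. T0 \<le> t \<Longrightarrow> heading t a = p"
  shows "explored n 2 C \<or> (\<exists>T\<ge>T0. \<forall>t\<ge>T. node (C t a) = node (C T a))"
proof (rule disjCI)
  assume "\<not> (\<exists>T\<ge>T0. \<forall>t\<ge>T. node (C t a) = node (C T a))"
  then have mv: "\<exists>u\<ge>t. node (C u a) \<noteq> node (C t a)" if "T0 \<le> t" for t using that by blast
  let ?W = "{node (C t a) | t. T0 \<le> t}"
  have "{..<n} \<subseteq> ?W"
  proof (rule neighbour_closed_all[of _ _ "node (C T0 a)" p])
    fix i assume "i \<in> ?W"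
    then obtain t where t: "i = node (C t a)" "T0 \<le> t" by blast
    obtain u where "u \<ge> t" "node (C u a) \<noteq> node (C t a)" using mv[OF t(2)] by blast
    then obtain v where "v > t" "node (C v a) = neighbour n i p"
      using moves_on[OF a, of t u p] p t by auto
    then show "neighbour n i p \<in> ?W"
      using t by (metis (mono_tags, lifting) le_trans less_imp_le mem_Collect_eq)
  qed (use node_less[OF a] in auto)
  then show "explored n 2 C" using a by (intro exploredI) blast
qed

text \<open>Whenever the agent is active its edge must be missing, for otherwise it would cross.
  Were the edge present infinitely often, eventual transport would provide an active round with the
  edge present.\<close>

lemma blocked_forever:
  assumes a: "a < 2" and stop: "\<And>t. T \<le> t \<Longrightarrow> node (C t a) = i"
    and p: "\<And>t. T \<le> t \<Longrightarrow> heading t a = p"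
    and on: "port (C T a) = Some p"
  shows "T \<le> t \<Longrightarrow> port (C t a) = Some p" and "\<exists>U. \<forall>u\<ge>U. E u = Some (edge_at n i p)"
proof -
  have i: "i < n" using node_less[OF a] stop by blast
  have adv: "advances u a" if "a \<in> S u" "T \<le> u" "port (C u a) = Some p" for u
    using active_cases[OF that(1)] that p[of "Suc u"] by auto
  have miss: "E u = Some (edge_at n i p) \<and> port (C (Suc u) a) = Some p"
    if "a \<in> S u" "T \<le> u" "port (C u a) = Some p" for u
    using adv[OF that] that p[of "Suc u"] stop[of u] stop[of "Suc u"] neighbour_neq[OF n i]
    unfolding advances_def by (auto simp: Let_def split: if_splits)
  show port: "port (C t a) = Some p" if "T \<le> t" for t
    using that
  proof (induction t rule: dec_induct)
    case (step u)
    then show ?case using miss[of u] asleep[OF a, of u] by (cases "a \<in> S u") auto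
  qed (rule on)
  have "finite {u. E u \<noteq> Some (edge_at n i p)}"
  proof (rule ccontr)
    assume inf: "infinite {u. E u \<noteq> Some (edge_at n i p)}"
    then obtain u where u: "u \<ge> T" "E u \<noteq> Some (edge_at n i p)"
      by (metis (mono_tags, lifting) finite_nat_set_iff_bounded linorder_not_less mem_Collect_eq)
    \<comment> \<open>Eventual transport speaks of sleeping agents only; with its edge present in
      round \<open>u\<close>, this agent must be asleep.\<close>
    then have "a \<notin> S u" using miss port by blast
    then obtain v where "v > u" "a \<in> S v" "E v \<noteq> Some (edge_at n i p)"
      using et a port[OF u(1)] inf stop[OF u(1)] unfolding eventual_transport_def Let_def by metis
    then show False using miss[of v] port[of v] u by auto
  qed
  then show "\<exists>U. \<forall>u\<ge>U. E u = Some (edge_at n i p)"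
    by (metis (mono_tags, lifting) finite_nat_set_iff_bounded_le mem_Collect_eq not_less_eq_eq)
qed

lemma next_active:
  assumes a: "a < 2"
  obtains t where "T \<le> t" "a \<in> S t" "C t a = C T a"
proof -
  have ex: "\<exists>t. T \<le> t \<and> a \<in> S t" using S_inf[OF a]
    by (metis (mono_tags, lifting) finite_nat_set_iff_bounded linorder_not_less mem_Collect_eq)
  define t where "t = (LEAST t. T \<le> t \<and> a \<in> S t)"
  have t: "T \<le> t" "a \<in> S t" using LeastI_ex[OF ex] unfolding t_def by auto
  have "C u a = C T a" if "T \<le> u" "u \<le> t" for u
    using that
  proof (induction u rule: dec_induct)
    case (step u)
    then have "a \<notin> S u" using not_less_Least[of u "\<lambda>t. T \<le> t \<and> a \<in> S t"] unfolding t_def by auto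
    then show ?case using step asleep[OF a] by simp
  qed simp
  then show ?thesis using that t by blast
qed

lemma heading_no_bounce:
  assumes "a \<in> S t" "heading (Suc t) a = heading t a"
  shows "\<not> bounces t a"
proof
  assume "bounces t a"
  then have "mem (C t a) = 0" "mem (C (Suc t) a) = 1"
    using mem_Suc[OF assms(1)] unfolding bounces_def by auto
  then show False using assms(2) unfolding heading_def by simp
qed

text \<open>An agent that stays off the ports is always denied its port by the other agent at the
  same node. Both then head left, the other one remains on the left port by
  \<open>blocked_forever\<close>, and the next activation of \<open>a\<close> makes it turn, against
  its constant heading.\<close>

lemma stopped_reaches_port:
  assumes ab: "a < 2" "b < 2" "a \<noteq> b"
    and stop: "\<And>t. T \<le> t \<Longrightarrow> node (C t a) = i" "\<And>t. T \<le> t \<Longrightarrow> node (C t b) = j"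
    and p: "\<And>t. T \<le> t \<Longrightarrow> heading t a = p" "\<And>t. T \<le> t \<Longrightarrow> heading t b = q"
    and opp: "p = q \<Longrightarrow> p = l"
  shows "\<exists>t\<ge>T. port (C t a) = Some p"
proof (rule ccontr)
  assume "\<not> ?thesis"
  then have off: "port (C t a) = None" if "T \<le> t" for t
    using port_heading[OF ab(1), of t] p(1)[OF that] that by auto
  have i: "i < n" "j < n" using node_less ab stop by blast+
  \<comment> \<open>An agent that does not leave its node can advance only by being blocked on its
    port.\<close>
  have adv: "port (C (Suc t) c) = Some (heading (Suc t) c)"
    if "advances t c" "T \<le> t" "c = a \<or> c = b" for t c
    using that stop[of t] stop[of "Suc t"] neighbour_neq[OF n] i
    unfolding advances_def by (auto simp: Let_def split: if_splits)
  have sees: False if t: "T \<le> t" "port (C t b) = Some p" "i = j" for t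
  proof -
    have pq: "p = q" using port_heading[OF ab(2), of t] p that by auto
    \<comment> \<open>Only a left-walking agent reacts to an occupied port; \<open>opp\<close>
      excludes two agents that both walk right.\<close>
    then have pl: "p = l" by (rule opp)
    obtain u where u: "t \<le> u" "a \<in> S u" using next_active[OF ab(1)] .
    have "port (C u b) = Some p"
      using blocked_forever(1)[OF ab(2), of t j p u] stop p pq t u by auto
    moreover have "mem (C u a) = 0"
      using p(1)[of u] t u pl unfolding heading_def by (auto split: if_splits)
    ultimately have "bounces u a"
      unfolding bounces_def using ab off[of u] stop[of u] t u pl by force
    then show False using heading_no_bounce[OF u(2)] p(1)[of u] p(1)[of "Suc u"] t u by simp
  qed
  obtain t where t: "T \<le> t" "a \<in> S t" using next_active[OF ab(1)] .
  have "\<not> advances t a" using adv[of t a] t off[of "Suc t"] by auto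
  then obtain c where c: "c < 2" "c \<noteq> a" "node (C t c) = node (C t a)"
     "port (C t c) = Some p \<or> heading (Suc t) c = p \<and> advances t c"
    using active_cases[OF t(2)] p(1)[of "Suc t"] t by auto
  have "c = b" using c ab by arith
  \<comment> \<open>Either \<open>b\<close> occupied the port in round \<open>t\<close>, or it won
    the port and is on it one round later.\<close>
  then have "port (C t b) = Some p \<or> port (C (Suc t) b) = Some p" "i = j"
    using c adv[of t b] t stop by auto
  then show False using sees[of t] sees[of "Suc t"] t by auto
qed

text \<open>Both wanted edges are missing from some round on, and a round has at most one missing
  edge. Equal headings would then put both agents on the same port of the same node.\<close>

lemma stopped_same_edge:
  assumes ab: "a < 2" "b < 2" "a \<noteq> b"
    and stop: "\<And>t. T \<le> t \<Longrightarrow> node (C t a) = i" "\<And>t. T \<le> t \<Longrightarrow> node (C t b) = j"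
    and p: "\<And>t. T \<le> t \<Longrightarrow> heading t a = p" "\<And>t. T \<le> t \<Longrightarrow> heading t b = q"
    and opp: "p = q \<Longrightarrow> p = l"
  shows "edge_at n i p = edge_at n j q" "p \<noteq> q"
proof -
  obtain t where t: "T \<le> t" "port (C t a) = Some p"
    using stopped_reaches_port[where T = T, OF ab stop p opp] by auto
  obtain u where u: "T \<le> u" "port (C u b) = Some q"
    using stopped_reaches_port[where T = T, OF ab(2,1) ab(3)[symmetric] stop(2,1) p(2,1)] opp by auto
  have stop': "t \<le> v \<Longrightarrow> node (C v a) = i" "u \<le> v \<Longrightarrow> node (C v b) = j"
    and p': "t \<le> v \<Longrightarrow> heading v a = p" "u \<le> v \<Longrightarrow> heading v b = q" for v
    using t(1) u(1) stop[of v] p[of v] by (meson le_trans)+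
  note pa = blocked_forever(1)[OF ab(1) stop'(1) p'(1) t(2)]
    and pb = blocked_forever(1)[OF ab(2) stop'(2) p'(2) u(2)]
  obtain U where U: "\<forall>v\<ge>U. E v = Some (edge_at n i p)"
    using blocked_forever(2)[OF ab(1) stop'(1) p'(1) t(2)] by blast
  obtain V where V: "\<forall>v\<ge>V. E v = Some (edge_at n j q)"
    using blocked_forever(2)[OF ab(2) stop'(2) p'(2) u(2)] by blast
  show eq: "edge_at n i p = edge_at n j q"
    using U[rule_format, of "max U V"] V[rule_format, of "max U V"] by simp
  show "p \<noteq> q"
  proof
    assume "p = q"
    moreover have "i < n" "j < n" using node_less ab stop by blast+
    ultimately have "i = j" using eq edge_at_inj by blast
    then have "node (C (max t u) a) = node (C (max t u) b)" using stop'[of "max t u"] by simp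
    moreover have "port (C (max t u) a) = Some p" "port (C (max t u) b) = Some q"
      using pa[of "max t u"] pb[of "max t u"] by simp_all
    ultimately show False
      using exclusive[of "max t u", unfolded ports_exclusive_def, rule_format, OF ab] \<open>p = q\<close>
      by simp
  qed
qed

section \<open>Exploration without and with a turn\<close>

text \<open>Two stopped agents have different headings, but without a turn both always head to
  \<open>l\<close>.\<close>

lemma explored_no_bounce:
  assumes m: "\<And>t a. a < 2 \<Longrightarrow> mem (C t a) = 0"
  shows "explored n 2 C"
proof (rule ccontr)
  assume ne: "\<not> explored n 2 C"
  have h: "a < 2 \<Longrightarrow> heading t a = l" for t a using m by (simp add: heading_def)
  obtain T where T: "\<forall>t\<ge>T. node (C t 0) = node (C T 0)"
    using explored_or_stops[of 0 0 l] ne h by auto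
  obtain U where U: "\<forall>t\<ge>U. node (C t 1) = node (C U 1)"
    using explored_or_stops[of 1 0 l] ne h by auto
  have stop: "node (C t 0) = node (C T 0)" "node (C t 1) = node (C U 1)" if "max T U \<le> t" for t
    using T U that by (meson max.boundedE)+
  show False
    using stopped_same_edge(2)[of 0 1 "max T U", OF _ _ _ stop h h] by simp
qed

text \<open>If both agents stop, the nodes visited by either since round \<open>t0\<close> are
  closed under going to \<open>l\<close>: \<open>b\<close> walks that way until it is blocked,
  \<open>a\<close> stands across the blocked edge, and each step of \<open>a\<close> is undone by a
  step to \<open>l\<close>.\<close>

lemma explored_bounce:
  assumes a: "a < 2" and m: "mem (C t0 a) = 0" "mem (C (Suc t0) a) \<noteq> 0"
  shows "explored n 2 C"
proof (rule ccontr)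
  assume ne: "\<not> explored n 2 C"
  have "bounces t0 a" using mem_mono[OF a, of t0] m by auto
  then obtain b where b: "b < 2" "b \<noteq> a" "node (C t0 b) = node (C t0 a)"
    unfolding bounces_def by blast
  have ma: "mem (C t a) \<noteq> 0" if "Suc t0 \<le> t" for t
    using that
  proof (induction t rule: dec_induct)
    case (step t)
    then show ?case using mem_mono[OF a, of t] by auto
  qed (rule m)
  then have mb: "mem (C t b) = 0" if "Suc t0 \<le> t" for t
    using one_bouncer[OF a b(1) b(2)[symmetric], of t] ma[OF that] by auto
  have ha: "heading t a = opposite l" and hb: "heading t b = l" if "Suc t0 \<le> t" for t
    using ma mb that unfolding heading_def by auto
  obtain T where T: "Suc t0 \<le> T" "\<forall>t\<ge>T. node (C t a) = node (C T a)"
    using explored_or_stops[OF a ha] ne by auto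
  obtain U where U: "Suc t0 \<le> U" "\<forall>t\<ge>U. node (C t b) = node (C U b)"
    using explored_or_stops[OF b(1) hb] ne by auto
  define i j where "i = node (C T a)" and "j = node (C U b)"
  have stop: "node (C t a) = i" "node (C t b) = j"
    and head: "heading t a = opposite l" "heading t b = l" if "max T U \<le> t" for t
  proof -
    have "T \<le> t" "U \<le> t" "Suc t0 \<le> t" using that T(1) by simp_all
    then show "node (C t a) = i" "node (C t b) = j" "heading t a = opposite l" "heading t b = l"
      unfolding i_def j_def by (blast intro: T(2)[rule_format] U(2)[rule_format] ha hb)+
  qed
  have "edge_at n i (opposite l) = edge_at n j l"
    by (rule stopped_same_edge(1)[where T = "max T U", OF a b(1) b(2)[symmetric] stop head]) auto
  then have meet: "neighbour n j l = i"
    using edge_at_opposite[of j n i l] node_less a b unfolding i_def j_def by simp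
  \<comment> \<open>Counting from \<open>t0\<close>, not \<open>Suc t0\<close>, puts the common node
    from which the agents part into both sets.\<close>
  define Va Vb where "Va = {node (C t a) | t. t0 \<le> t}" and "Vb = {node (C t b) | t. t0 \<le> t}"
  have step_b: "neighbour n (node (C t b)) l \<in> Va \<union> Vb" if "t0 \<le> t" for t
  proof (cases "node (C t b) = j")
    case True
    have "i \<in> Va" unfolding Va_def i_def using T(1) Suc_leD by blast
    then show ?thesis using True meet by simp
  next
    case False
    have "node (C (max t U) b) \<noteq> node (C t b)"
      using U(2)[rule_format, of "max t U"] False unfolding j_def by auto
    moreover have "heading v b = l" if "t < v" for v using hb \<open>t0 \<le> t\<close> that by simp
    ultimately obtain v where "v > t" "node (C v b) = neighbour n (node (C t b)) l"
      using moves_on[OF b(1), of t "max t U" l] by (meson max.cobounded1)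
    moreover from this have "t0 \<le> v" using that by simp
    ultimately show ?thesis unfolding Vb_def by auto
  qed
  have step_a: "neighbour n (node (C t a)) l \<in> Va \<union> Vb" if "t0 \<le> t" for t
    using that
  proof (induction t rule: dec_induct)
    case base
    then show ?case using step_b[of t0] b(3) by simp
  next
    case (step t)
    \<comment> \<open>If \<open>a\<close> moves in round \<open>t\<close>, the
      \<open>l\<close>-neighbour of its new node is the node it has just left.\<close>
    have "node (C t a) \<in> Va" unfolding Va_def using step by blast
    then show ?case
      using node_Suc[OF a, of t] ha[of "Suc t"] step neighbour_opposite[OF node_less[OF a], of t l]
      by (auto simp del: neighbour.simps)
  qed
  have "{..<n} \<subseteq> Va \<union> Vb"
  proof (rule neighbour_closed_all)
    show "Va \<union> Vb \<subseteq> {..<n}" using node_less a b unfolding Va_def Vb_def by auto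
    show "node (C t0 a) \<in> Va \<union> Vb" unfolding Va_def by blast
    show "\<And>x. x \<in> Va \<union> Vb \<Longrightarrow> neighbour n x l \<in> Va \<union> Vb"
      using step_a step_b unfolding Va_def Vb_def by blast
  qed
  then have "explored n 2 C" using a b unfolding Va_def Vb_def by (intro exploredI) blast
  then show False using ne by blast
qed

lemma explored: "explored n 2 C"
proof (cases "\<forall>t a. a < 2 \<longrightarrow> mem (C t a) = 0")
  case False
  then obtain t a where ta: "a < 2" "mem (C t a) \<noteq> 0" by blast
  have "mem (C 0 a) = 0"
    using exec ta unfolding ssync_execution_def initial_def bounce_def by simp
  then obtain u where "mem (C u a) = 0" "mem (C (Suc u) a) \<noteq> 0"
    using ta(2) by (induction t) auto
  then show ?thesis using explored_bounce ta by blast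
qed (use explored_no_bounce in blast)

end

section \<open>A common left port, and the conclusion\<close>

text \<open>What agent 0 calls left at node 0 settles the matter: consistency carries it to the
  other nodes, chirality to the other agents.\<close>

lemma common_left:
  assumes "consistent_orientation n k lam" "chirality n k lam" "0 < n" "0 < k"
  obtains l where "\<And>a i p. a < k \<Longrightarrow> i < n \<Longrightarrow> lam a i p = (if p = l then Left else Right)"
proof -
  define l where "l = (if lam 0 0 Plus = Left then Plus else Minus)"
  have ne: "lam 0 0 Minus \<noteq> lam 0 0 Plus"
    using assms unfolding consistent_orientation_def by blast
  have "lam a i p = (if p = l then Left else Right)" if "a < k" "i < n" for a i p
  proof -
    have "lam a i p = lam 0 0 p"
      using assms that unfolding consistent_orientation_def chirality_def by metis
    then show ?thesis using ne unfolding l_def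
      by (cases p; cases "lam 0 0 Plus"; cases "lam 0 0 Minus") auto
  qed
  then show ?thesis using that by blast
qed

theorem theorem18:
  "\<exists>P :: nat protocol. \<forall>n\<ge>1. unconscious_exploration_ET_chirality n 2 P"
proof (intro exI[of _ bounce] allI impI)
  fix n :: nat
  assume n: "1 \<le> n"
  show "unconscious_exploration_ET_chirality n 2 bounce"
    unfolding unconscious_exploration_ET_chirality_def
  proof (intro allI impI)
    fix lam S E and C :: "nat \<Rightarrow> nat config"
    assume *: "consistent_orientation n 2 lam" "chirality n 2 lam"
      and exec: "ssync_execution n 2 bounce lam S E C" "eventual_transport n 2 S E C"
    show "explored n 2 C"
    proof (cases "n = 1")
      case True
      \<comment> \<open>The only node of the ring is occupied from the start.\<close>
      then have "node (C 0 0) = 0"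
        using exec unfolding ssync_execution_def initial_def by auto
      then show ?thesis using True by (intro exploredI) (auto intro!: exI[of _ 0])
    next
      case False
      obtain l where "\<And>a i p. a < 2 \<Longrightarrow> i < n \<Longrightarrow> lam a i p = (if p = l then Left else Right)"
        using common_left[OF *] n by auto
      then interpret bounce_execution n lam S E C l
        using exec n False by unfold_locales auto
      show ?thesis by (rule explored)
    qed
  qed
qed

end
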